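(* Let $S\subseteq\{0,1\}^n$, let $f:\mathbb{R}^n\to\mathbb{R}$ be linear, let $\zeta=\min\{f(x):x\in S\}$, and let $S^*$ be the set of optimal solutions of this problem. Let $\eta\in\mathbb{R}$ be an upper bound of $\zeta$, i.e. $\zeta\le\eta$. Let $g\in\mathbb{Z}^n$ and $\alpha\in\mathbb{Z}$, and put $S(\alpha)=\{x\in S: g^Tx\le\alpha\}$. Let $\widehat S(\alpha)\subseteq\mathbb{R}^n$ be a closed convex set with $S(\alpha)\subseteq\widehat S(\alpha)$, let $\hat f:\mathbb{R}^n\to\mathbb{R}$ be linear with $\hat f(x)=f(x)$ for every $x\in S$, and let $\hat\zeta(\alpha)=\min\{\hat f(x):x\in\widehat S(\alpha)\}$. If $\eta<\hat\zeta(\alpha)$, then $g^Tx\ge\alpha+1$ is a cutting inequality for $S^*$, that is, $g^Tx\ge\alpha+1$ holds for every $x\in S^*$.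
   Context: For the minimization over $\widehat S(\alpha)$, "min" denotes the infimum in $[-\infty,+\infty]$, with value $+\infty$ when $\widehat S(\alpha)$ is empty. The problem $\min\{\hat f(x):x\in\widehat S(\alpha)\}$ is called a conic relaxation of the subproblem $\min\{f(x):x\in S(\alpha)\}$. The lifted space of the relaxation is identified with $\mathbb{R}^n$ and $f$ is taken to be linear. *)

theory Defs
  imports "HOL-Analysis.Analysis"
begin

definition binary_cube :: "(real ^ 'n) set" where
  "binary_cube = {x. \<forall>i. x $ i \<in> {0, 1}}"

definition int_inner :: "int ^ 'n \<Rightarrow> real ^ 'n \<Rightarrow> real" where
  "int_inner g x = (\<Sum>i\<in>UNIV. of_int (g $ i) * x $ i)"

(* "min" is the infimum in [-\<infinity>, +\<infinity>]; it is +\<infinity> on the empty set. *)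
definition opt_value :: "('a \<Rightarrow> real) \<Rightarrow> 'a set \<Rightarrow> ereal" where
  "opt_value f A = (INF x\<in>A. ereal (f x))"

definition opt_solutions :: "('a \<Rightarrow> real) \<Rightarrow> 'a set \<Rightarrow> 'a set" where
  "opt_solutions f A = {x \<in> A. ereal (f x) = opt_value f A}"

definition subproblem_set :: "(real ^ 'n) set \<Rightarrow> int ^ 'n \<Rightarrow> int \<Rightarrow> (real ^ 'n) set" where
  "subproblem_set S g \<alpha> = {x \<in> S. int_inner g x \<le> of_int \<alpha>}"

definition cutting_inequality :: "int ^ 'n \<Rightarrow> int \<Rightarrow> (real ^ 'n) set \<Rightarrow> bool" where
  "cutting_inequality g \<beta> T \<longleftrightarrow> (\<forall>x\<in>T. int_inner g x \<ge> of_int \<beta>)"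

end

theory Submission
  imports Defs
begin

text \<open>
  An optimal solution with \<open>g\<^sup>T x \<le> \<alpha>\<close> would be feasible for the relaxation, where its
  objective value equals the optimum and hence is at most \<open>\<eta>\<close>; this contradicts the relaxation
  bound exceeding \<open>\<eta>\<close>. So \<open>g\<^sup>T x > \<alpha>\<close> at every optimal solution, and since both sides are
  integers at binary points (\<open>int_inner_binary_Ints\<close>), the inequality can be rounded up to
  \<open>g\<^sup>T x \<ge> \<alpha> + 1\<close>.
\<close>

lemma int_inner_binary_Ints:
  assumes "x \<in> binary_cube"
  shows "int_inner g x \<in> \<int>"
  unfolding int_inner_def
proof (rule Ints_sum)
  fix i
  have "x $ i = 0 \<or> x $ i = 1"
    using assms by (simp add: binary_cube_def)
  then show "of_int (g $ i) * x $ i \<in> \<int>"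
    by auto
qed

theorem mainTheorem1:
  fixes S S_hat :: "(real ^ 'n) set"
    and f f_hat :: "real ^ 'n \<Rightarrow> real"
    and g :: "int ^ 'n"
    and \<alpha> :: int
    and \<eta> :: real
  assumes "S \<subseteq> binary_cube"
    and "linear f"
    and "opt_value f S \<le> ereal \<eta>"
    and "closed S_hat"
    and "convex S_hat"
    and "subproblem_set S g \<alpha> \<subseteq> S_hat"
    and "linear f_hat"
    and "\<forall>x\<in>S. f_hat x = f x"
    and "ereal \<eta> < opt_value f_hat S_hat"
  shows "cutting_inequality g (\<alpha> + 1) (opt_solutions f S)"
  unfolding cutting_inequality_def
proof
  fix x
  assume "x \<in> opt_solutions f S"
  then have xS: "x \<in> S" and opt: "ereal (f x) = opt_value f S"
    by (auto simp: opt_solutions_def)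
  have "\<not> int_inner g x \<le> of_int \<alpha>"
  proof
    assume "int_inner g x \<le> of_int \<alpha>"
    with xS assms(6) have "x \<in> S_hat"
      by (auto simp: subproblem_set_def)
    then have "opt_value f_hat S_hat \<le> ereal (f_hat x)"
      unfolding opt_value_def by (rule INF_lower)
    also have "\<dots> = opt_value f S"
      using assms(8) xS opt by simp
    also have "\<dots> \<le> ereal \<eta>"
      by (fact assms(3))
    finally show False
      using assms(9) by simp
  qed
  moreover obtain k where "int_inner g x = of_int k"
    using int_inner_binary_Ints assms(1) xS by (blast elim: Ints_cases)
  ultimately show "of_int (\<alpha> + 1) \<le> int_inner g x"
    by simp
qed

end
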